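(* For every integer $k\geq 9$, we have $\mathrm{URT}(k)\leq \mathrm{RT}(\lfloor k/3\rfloor)$.
   Context: For a word $x=x_1\cdots x_n$ (letters $x_i$), its reversal is $x^R=x_n\cdots x_1$. For rational $1<r\leq 2$, an (ordinary) $r$-power is a word $xyx$ with $x$ nonempty and $|xyx|/|xy|=r$; an undirected $r$-power is a word $xyx'$ with $x$ nonempty, $x'\in\{x,x^R\}$, and $|xyx'|/|xy|=r$. For real $1<\alpha\leq 2$, a word is (undirected) $\alpha$-free if none of its factors is an (undirected, respectively) $r$-power for any rational $r\geq\alpha$, and $\alpha^+$-free if none of its factors is such an $r$-power with $r>\alpha$. Undirected $r$-powers are $k$-avoidable if there is an infinite word over a $k$-letter alphabet that is undirected $r$-free. The undirected repetition threshold is $\mathrm{URT}(k)=\inf\{r : \text{undirected } r\text{-powers are } k\text{-avoidable}\}$, and the (ordinary) repetition threshold $\mathrm{RT}(k)$ is defined analogously using ordinary $r$-powers ($\mathrm{RT}(k)=\inf\{r: \text{there is an infinite } k\text{-ary word that is } r\text{-free}\}$). *)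

theory Defs
  imports Complex_Main "HOL-Library.Omega_Words_Fun"
begin

text \<open>
  Finite words are lists; right-infinite words are functions \<open>nat \<Rightarrow> 'a\<close>
  (type \<open>'a word\<close> of \<open>Omega_Words_Fun\<close>).  In both power definitions
  \<open>x \<noteq> []\<close> already forces \<open>1 < r \<le> 2\<close>.
\<close>

definition ordinary_power :: "rat \<Rightarrow> 'a list \<Rightarrow> bool" where
  "ordinary_power r u \<longleftrightarrow>
     (\<exists>x y. u = x @ y @ x \<and> x \<noteq> [] \<and>
        of_nat (length (x @ y @ x)) / of_nat (length (x @ y)) = r)"

definition undirected_power :: "rat \<Rightarrow> 'a list \<Rightarrow> bool" where
  "undirected_power r u \<longleftrightarrow>
     (\<exists>x y x'. u = x @ y @ x' \<and> x \<noteq> [] \<and> x' \<in> {x, rev x} \<and>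
        of_nat (length (x @ y @ x')) / of_nat (length (x @ y)) = r)"

definition factors :: "'a word \<Rightarrow> 'a list set" where
  "factors w = {subsequence w i j | i j. i \<le> j}"

definition ordinary_free :: "real \<Rightarrow> 'a word \<Rightarrow> bool" where
  "ordinary_free \<alpha> w \<longleftrightarrow>
     (\<forall>u \<in> factors w. \<forall>r. real_of_rat r \<ge> \<alpha> \<longrightarrow> \<not> ordinary_power r u)"

definition undirected_free :: "real \<Rightarrow> 'a word \<Rightarrow> bool" where
  "undirected_free \<alpha> w \<longleftrightarrow>
     (\<forall>u \<in> factors w. \<forall>r. real_of_rat r \<ge> \<alpha> \<longrightarrow> \<not> undirected_power r u)"

text \<open>The \<open>k\<close>-letter alphabet is \<open>{0, \<dots>, k - 1}\<close>.\<close>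

definition ordinary_avoidable :: "nat \<Rightarrow> real \<Rightarrow> bool" where
  "ordinary_avoidable k r \<longleftrightarrow> (\<exists>w :: nat word. range w \<subseteq> {..<k} \<and> ordinary_free r w)"

definition undirected_avoidable :: "nat \<Rightarrow> real \<Rightarrow> bool" where
  "undirected_avoidable k r \<longleftrightarrow> (\<exists>w :: nat word. range w \<subseteq> {..<k} \<and> undirected_free r w)"

text \<open>
  The bound \<open>r \<le> 2\<close> is essential: no power as defined above has exponent greater
  than 2, so every word would vacuously be \<open>r\<close>-free for \<open>r > 2\<close>.  The sets below
  can be empty for small alphabets (such as \<open>k = 2\<close>), where \<open>Inf\<close> is unspecified.
\<close>

definition RT :: "nat \<Rightarrow> real" where
  "RT k = Inf {r. 1 < r \<and> r \<le> 2 \<and> ordinary_avoidable k r}"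

definition URT :: "nat \<Rightarrow> real" where
  "URT k = Inf {r. 1 < r \<and> r \<le> 2 \<and> undirected_avoidable k r}"

end

theory Submission
  imports Defs
begin

text \<open>
  Replace every letter \<open>a\<close> of an \<open>r\<close>-free word by a block of three letters private to \<open>a\<close>.
  A letter of the new word determines its position modulo 3, so no factor of length 2 occurs
  reversed, and undirected powers are ordinary ones.  The period of such a power is a multiple
  of 3, and completing the partial blocks at the ends of both copies of the repeated part yields
  a power of at least the same exponent in the original word.  Hence \<open>3 * j\<close> letters suffice for
  every exponent that is avoidable by \<open>j\<close> letters.  The infimum defining \<open>RT j\<close> is over a nonempty
  set for \<open>j \<ge> 3\<close>, since the first differences of the Thue-Morse word form a square-free
  ternary word.
\<close>

section \<open>Powers in infinite words as equations between positions\<close>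

lemma mem_factors_iff: "u \<in> factors w \<longleftrightarrow> (\<exists>i. \<forall>m<length u. u ! m = w (i + m))"
proof
  assume "u \<in> factors w"
  then obtain i j where "u = map w [i..<j]"
    by (auto simp: factors_def subsequence_def)
  then show "\<exists>i. \<forall>m<length u. u ! m = w (i + m)"
    by auto
next
  assume "\<exists>i. \<forall>m<length u. u ! m = w (i + m)"
  then obtain i where "\<forall>m<length u. u ! m = w (i + m)" by blast
  then have "u = map w [i..<i + length u]"
    by (intro nth_equalityI) auto
  then have "u = subsequence w i (i + length u)"
    by (simp add: subsequence_def)
  then show "u \<in> factors w"
    unfolding factors_def using le_add1 by blast
qed

lemma append_mem_factors_iff:
  "x @ y @ z \<in> factors w \<longleftrightarrow>
    (\<exists>i. (\<forall>m<length x. x ! m = w (i + m)) \<and>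
         (\<forall>m<length y. y ! m = w (i + length x + m)) \<and>
         (\<forall>m<length z. z ! m = w (i + length (x @ y) + m)))"
  (is "?L \<longleftrightarrow> ?R")
proof
  assume ?L
  then obtain i where i: "\<forall>m<length (x @ y @ z). (x @ y @ z) ! m = w (i + m)"
    unfolding mem_factors_iff by blast
  have "x ! m = w (i + m)" if "m < length x" for m
    using i[rule_format, of m] that by (simp add: nth_append)
  moreover have "y ! m = w (i + length x + m)" if "m < length y" for m
    using i[rule_format, of "length x + m"] that by (simp add: nth_append add.assoc)
  moreover have "z ! m = w (i + length (x @ y) + m)" if "m < length z" for m
    using i[rule_format, of "length x + length y + m"] that
    by (simp add: nth_append add.assoc)
  ultimately show ?R by blast
next
  assume ?R
  then obtain i where i: "\<forall>m<length x. x ! m = w (i + m)"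
    "\<forall>m<length y. y ! m = w (i + length x + m)"
    "\<forall>m<length z. z ! m = w (i + length (x @ y) + m)" by blast
  have "(x @ y @ z) ! m = w (i + m)" if "m < length (x @ y @ z)" for m
    using i(1)[rule_format, of m] i(2)[rule_format, of "m - length x"]
      i(3)[rule_format, of "m - length x - length y"] that
    by (simp add: nth_append split: if_splits)
  then show ?L
    unfolding mem_factors_iff by blast
qed

text \<open>For a factor xyx that starts at \<open>i\<close>, the number \<open>p\<close> is the
  period |xy| and \<open>l\<close> is |x|; an empty y gives \<open>l = p\<close>.\<close>

lemma ordinary_freeI:
  assumes "\<And>i p l. \<lbrakk>0 < l; l \<le> p; \<And>m. m < l \<Longrightarrow> w (i + m) = w (i + p + m)\<rbrakk>
    \<Longrightarrow> real (p + l) / real p < \<alpha>"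
  shows "ordinary_free \<alpha> w"
  unfolding ordinary_free_def
proof (intro ballI allI impI notI)
  fix u r assume u: "u \<in> factors w" and r: "\<alpha> \<le> real_of_rat r" and "ordinary_power r u"
  then obtain x y where xy: "u = x @ y @ x" "x \<noteq> []"
    "of_nat (length (x @ y @ x)) / of_nat (length (x @ y)) = r"
    unfolding ordinary_power_def by blast
  from u obtain i where "\<forall>m<length x. x ! m = w (i + m)"
    "\<forall>m<length x. x ! m = w (i + length (x @ y) + m)"
    unfolding xy append_mem_factors_iff by blast
  then have "real (length (x @ y) + length x) / real (length (x @ y)) < \<alpha>"
    using xy(2) by (intro assms[of _ _ i]) auto
  moreover have "real_of_rat r = real (length (x @ y) + length x) / real (length (x @ y))"
    unfolding xy(3)[symmetric] of_rat_divide of_rat_of_nat_eq by (simp add: add_ac)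
  ultimately show False using r by simp
qed

lemma ordinary_freeD:
  assumes "ordinary_free \<alpha> w" "0 < l" "l \<le> p"
    and eq: "\<And>m. m < l \<Longrightarrow> w (i + m) = w (i + p + m)"
  shows "real (p + l) / real p < \<alpha>"
proof (rule ccontr)
  assume *: "\<not> real (p + l) / real p < \<alpha>"
  define x where "x = map w [i..<i + l]"
  define y where "y = map w [i + l..<i + p]"
  define r :: rat where "r = of_nat (p + l) / of_nat p"
  have len: "length x = l" "length (x @ y) = p" "length (x @ y @ x) = p + l"
    using \<open>l \<le> p\<close> by (auto simp: x_def y_def)
  have "x @ y @ x \<in> factors w"
    unfolding append_mem_factors_iff len using eq len
    by (intro exI[of _ i]) (auto simp: x_def y_def)
  moreover have "ordinary_power r (x @ y @ x)"
    unfolding ordinary_power_def using len \<open>0 < l\<close>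
    by (intro exI[of _ x] exI[of _ y]) (auto simp: r_def)
  moreover have "\<alpha> \<le> real_of_rat r"
    using * unfolding r_def of_rat_divide of_rat_of_nat_eq by simp
  ultimately show False
    using assms(1) unfolding ordinary_free_def by blast
qed

text \<open>The second premise treats x' = \<open>rev x\<close>: letter \<open>m\<close> of x meets
  the letter of x' at offset \<open>l - Suc m\<close>.\<close>

lemma undirected_freeI:
  assumes "\<And>i p l. \<lbrakk>0 < l; l \<le> p; \<And>m. m < l \<Longrightarrow> w (i + m) = w (i + p + m)\<rbrakk>
    \<Longrightarrow> real (p + l) / real p < \<alpha>"
    and "\<And>i p l. \<lbrakk>0 < l; l \<le> p; \<And>m. m < l \<Longrightarrow> w (i + m) = w (i + p + (l - Suc m))\<rbrakk>
    \<Longrightarrow> real (p + l) / real p < \<alpha>"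
  shows "undirected_free \<alpha> w"
  unfolding undirected_free_def
proof (intro ballI allI impI notI)
  fix u r assume u: "u \<in> factors w" and r: "\<alpha> \<le> real_of_rat r" and "undirected_power r u"
  then obtain x y x' where xy: "u = x @ y @ x'" "x \<noteq> []" "x' \<in> {x, rev x}"
    "of_nat (length (x @ y @ x')) / of_nat (length (x @ y)) = r"
    unfolding undirected_power_def by blast
  have len: "length x' = length x" using xy(3) by auto
  from u obtain i where i: "\<forall>m<length x. x ! m = w (i + m)"
    "\<forall>m<length x. x' ! m = w (i + length (x @ y) + m)"
    unfolding xy append_mem_factors_iff len by blast
  have "real (length (x @ y) + length x) / real (length (x @ y)) < \<alpha>"
  proof (cases "x' = x")
    case True
    then show ?thesis using xy(2) i by (intro assms(1)[of _ _ i]) auto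
  next
    case False
    then have rev: "x' = rev x" using xy(3) by blast
    have "w (i + m) = w (i + length (x @ y) + (length x - Suc m))" if "m < length x" for m
      using i(1)[rule_format, OF that] i(2)[rule_format, of "length x - Suc m"] that
      by (simp add: rev rev_nth)
    then show ?thesis using xy(2) by (intro assms(2)[of _ _ i]) auto
  qed
  moreover have "real_of_rat r = real (length (x @ y) + length x) / real (length (x @ y))"
    unfolding xy(4)[symmetric] of_rat_divide of_rat_of_nat_eq by (simp add: add_ac len)
  ultimately show False using r by simp
qed

section \<open>The substitution a -> (3a)(3a+1)(3a+2)\<close>

definition triple_word :: "nat word \<Rightarrow> nat word" where
  "triple_word w n = 3 * w (n div 3) + n mod 3"

lemma triple_word_eq_iff:
  "triple_word w m = triple_word w n \<longleftrightarrow> w (m div 3) = w (n div 3) \<and> m mod 3 = n mod 3"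
proof -
  have "m mod 3 < 3" "n mod 3 < 3" by simp_all
  then show ?thesis unfolding triple_word_def by presburger
qed

lemma triple_word_repetition_bound:
  assumes free: "ordinary_free \<alpha> w" and "\<alpha> \<le> 2" and l: "0 < l" "l \<le> p"
    and eq: "\<And>m. m < l \<Longrightarrow> triple_word w (i + m) = triple_word w (i + p + m)"
  shows "real (p + l) / real p < \<alpha>"
proof -
  have "i mod 3 = (i + p) mod 3"
    using eq[of 0] l by (simp add: triple_word_eq_iff)
  then have "3 dvd p" by presburger
  then obtain q where q: "p = 3 * q" by blast
  \<comment> \<open>The first copy occupies the positions \<open>i\<close> to
    \<open>i + (l - 1)\<close>; it meets exactly the \<open>n\<close> blocks with indices
    \<open>b\<close> to \<open>e\<close>.\<close>
  define b where "b = i div 3"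
  define e where "e = (i + (l - 1)) div 3"
  define n where "n = Suc e - b"
  have "b \<le> e" unfolding b_def e_def by (simp add: div_le_mono)
  have b: "3 * b \<le> i" "i < 3 * b + 3" unfolding b_def by linarith+
  have "3 * e \<le> i + (l - 1)" "i + (l - 1) < 3 * e + 3" unfolding e_def by linarith+
  then have e: "3 * e < i + l" "i + l \<le> 3 * e + 3" using l(1) by auto
  have "0 < n" using \<open>b \<le> e\<close> unfolding n_def by simp
  have n: "l \<le> 3 * n" using l \<open>b \<le> e\<close> b e unfolding n_def by linarith
  have block: "w (b + s) = w (b + q + s)" if "s < n" for s
  proof -
    \<comment> \<open>This is the offset of the first letter of block \<open>b + s\<close> inside
      the copy. For \<open>s = 0\<close> the block may start before \<open>i\<close>, and truncated
      subtraction then gives offset 0. One letter of a block already determines the letter of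
      \<open>w\<close> behind it.\<close>
    define m where "m = 3 * (b + s) - i"
    have "b + s \<le> e" using that unfolding n_def by simp
    then have "3 * (b + s) \<le> 3 * e" by (rule mult_le_mono2)
    then have "3 * (b + s) < i + l" using e(1) by (rule le_less_trans)
    then have "m < l" using l(1) unfolding m_def by arith
    have "3 * (b + s) \<le> i + m" "i + m < 3 * (b + s) + 3"
      using b unfolding m_def by arith+
    then have "(i + m) div 3 = b + s" by (intro div_nat_eqI) simp_all
    moreover have "(i + p + m) div 3 = (i + m) div 3 + q" unfolding q by simp
    ultimately show ?thesis
      using eq[OF \<open>m < l\<close>] by (simp add: triple_word_eq_iff add_ac)
  qed
  have q0: "q > 0" using l q by simp
  show ?thesis
  proof (cases "n \<le> q")
    case True
    \<comment> \<open>With \<open>p = 3 * q\<close> and \<open>l \<le> 3 * n\<close>, the excess l/p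
      over 1 is at most n/q.\<close>
    have "real (p + l) / real p \<le> real (q + n) / real q"
      using n q0 by (simp add: q field_simps)
    also have "\<dots> < \<alpha>"
      using True block by (intro ordinary_freeD[OF free, of _ _ b]) (use \<open>0 < n\<close> in auto)
    finally show ?thesis .
  next
    case False
    \<comment> \<open>The completed copies overlap, but their first \<open>q\<close> blocks already
      form a square in \<open>w\<close>, whose exponent 2 is excluded only if 2 <
      \<open>\<alpha>\<close>.\<close>
    have "real (q + q) / real q < \<alpha>"
      using False block q0 by (intro ordinary_freeD[OF free, of _ _ b]) auto
    then show ?thesis using q0 \<open>\<alpha> \<le> 2\<close> by (simp add: field_simps)
  qed
qed

lemma undirected_free_triple_word:
  assumes free: "ordinary_free \<alpha> w" and "\<alpha> \<le> 2"
  shows "undirected_free \<alpha> (triple_word w)"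
proof (rule undirected_freeI)
  fix i p l
  assume l: "0 < l" "l \<le> p"
    and eq: "\<And>m. m < l \<Longrightarrow> triple_word w (i + m) = triple_word w (i + p + (l - Suc m))"
  \<comment> \<open>If \<open>l\<close> were at least 2, the first two letters of x would end x' in
    reverse order. Residues modulo 3 would then go up by 1 and down by 1 at once, which is
    impossible. A single letter is its own reversal, so the ordinary bound applies.\<close>
  have "l = 1"
  proof (rule ccontr)
    assume "l \<noteq> 1"
    then have "1 < l" using l by simp
    define n where "n = i + p + (l - 2)"
    have "i + p + (l - 1) = Suc n" using \<open>1 < l\<close> by (simp add: n_def)
    then have "i mod 3 = Suc n mod 3" "Suc i mod 3 = n mod 3"
      using eq[of 0] eq[of 1] \<open>1 < l\<close>
      by (simp_all add: triple_word_eq_iff n_def numeral_2_eq_2)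
    then show False by (auto simp: mod_Suc split: if_splits)
  qed
  then show "real (p + l) / real p < \<alpha>"
    using eq l by (intro triple_word_repetition_bound[OF assms, of _ _ i]) auto
qed (rule triple_word_repetition_bound[OF assms])

lemma undirected_avoidable_if_ordinary_avoidable:
  assumes "ordinary_avoidable (k div 3) r" "r \<le> 2"
  shows "undirected_avoidable k r"
proof -
  obtain w :: "nat word" where w: "range w \<subseteq> {..<k div 3}" "ordinary_free r w"
    using assms(1) unfolding ordinary_avoidable_def by blast
  \<comment> \<open>The largest possible letter is \<open>3 * (k div 3) - 1\<close>.\<close>
  have "triple_word w n < k" for n
  proof -
    have "w (n div 3) < k div 3" using w(1) by auto
    moreover have "n mod 3 < 3" by simp
    ultimately show ?thesis unfolding triple_word_def by linarith
  qed
  then show ?thesis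
    unfolding undirected_avoidable_def
    using undirected_free_triple_word[OF w(2) assms(2)] by blast
qed

section \<open>The Thue-Morse word and a square-free ternary word\<close>

fun thue_morse :: "nat \<Rightarrow> bool" where
  "thue_morse n = (if n = 0 then False else thue_morse (n div 2) \<noteq> odd n)"

declare thue_morse.simps [simp del]

lemma thue_morse_double [simp]: "thue_morse (2 * n) = thue_morse n"
  using thue_morse.simps[of "2 * n"] thue_morse.simps[of 0] by (cases "n = 0") auto

lemma thue_morse_Suc_double [simp]: "thue_morse (Suc (2 * n)) \<longleftrightarrow> \<not> thue_morse n"
  using thue_morse.simps[of "Suc (2 * n)"] by auto

lemma thue_morse_Suc_even: "even n \<Longrightarrow> thue_morse (Suc n) \<longleftrightarrow> \<not> thue_morse n"
  by (elim evenE) simp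

text \<open>Agreement at all \<open>p + 1\<close> offsets would be an overlap of period
  \<open>p\<close>. If \<open>p\<close> is even, the positions of one parity carry the word itself
  or its complement, so an overlap of half the period would arise; this drives the
  induction.\<close>

lemma thue_morse_overlap_free:
  assumes "0 < p"
  shows "\<exists>m\<le>p. thue_morse (i + m) \<noteq> thue_morse (i + p + m)"
  using assms
proof (induction p arbitrary: i rule: less_induct)
  case (less p)
  show ?case
  proof (cases "even p")
    case True
    then obtain q where q: "p = 2 * q" by (elim evenE)
    obtain m where m: "m \<le> q" "thue_morse (i div 2 + m) \<noteq> thue_morse (i div 2 + q + m)"
      using less.IH[of q "i div 2"] less.prems q by auto
    have "thue_morse (i + 2 * m) \<noteq> thue_morse (i + p + 2 * m)"
    proof (cases "even i")
      case True
      then have e: "i + 2 * m = 2 * (i div 2 + m)" "i + p + 2 * m = 2 * (i div 2 + q + m)"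
        using q by auto
      show ?thesis unfolding e thue_morse_double by (rule m(2))
    next
      case False
      then have e: "i + 2 * m = Suc (2 * (i div 2 + m))"
        "i + p + 2 * m = Suc (2 * (i div 2 + q + m))"
        using q by (auto elim!: oddE)
      show ?thesis unfolding e thue_morse_Suc_double using m(2) by blast
    qed
    then show ?thesis using m q by (intro exI[of _ "2 * m"]) simp
  next
    case False
    show ?thesis
    proof (rule ccontr)
      assume "\<not> ?thesis"
      then have eq: "thue_morse (i + m) = thue_morse (i + p + m)" if "m \<le> p" for m
        using that by blast
      \<comment> \<open>As \<open>p\<close> is odd, one of the positions \<open>i + m\<close> and \<open>i + p + m\<close> is even, so the letters alternate
        on the whole period, which contradicts the case \<open>m = 0\<close> of \<open>eq\<close>.\<close>
      have alt: "thue_morse (i + Suc m) \<longleftrightarrow> \<not> thue_morse (i + m)" if "m < p" for m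
      proof (cases "even (i + m)")
        case True
        then show ?thesis using thue_morse_Suc_even by simp
      next
        case odd: False
        then have "even (i + p + m)" using False by simp
        then have "thue_morse (i + p + Suc m) \<longleftrightarrow> \<not> thue_morse (i + p + m)"
          using thue_morse_Suc_even by simp
        then show ?thesis using eq[of m] eq[of "Suc m"] that by simp
      qed
      have "thue_morse (i + m) \<longleftrightarrow> thue_morse i \<noteq> odd m" if "m \<le> p" for m
        using that
      proof (induction m)
        case (Suc m)
        then show ?case using alt[of m] by auto
      qed simp
      from this[of p] eq[of 0] False show False by simp
    qed
  qed
qed

text \<open>The difference lies in {-1, 0, 1} and is shifted to {0, 1, 2}; adding 1 first keeps the
  subtraction on naturals from truncating.\<close>

definition thue_morse_diff :: "nat word" where
  "thue_morse_diff n = of_bool (thue_morse (Suc n)) + 1 - of_bool (thue_morse n)"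

lemma thue_morse_diff_less_3: "thue_morse_diff n < 3"
  by (simp add: thue_morse_diff_def)

lemma sum_thue_morse_diff:
  "(\<Sum>m<n. int (thue_morse_diff (i + m)) - 1)
    = of_bool (thue_morse (i + n)) - of_bool (thue_morse i)"
  by (induction n) (auto simp: thue_morse_diff_def)

text \<open>Equal differences have equal partial sums, so a square of period \<open>p\<close> here
  would lift to an overlap of period \<open>p\<close> in the Thue-Morse word.\<close>

lemma thue_morse_diff_square_free:
  assumes "0 < p"
  shows "\<exists>m<p. thue_morse_diff (i + m) \<noteq> thue_morse_diff (i + p + m)"
proof (rule ccontr)
  assume "\<not> ?thesis"
  then have eq: "thue_morse_diff (i + m) = thue_morse_diff (i + p + m)" if "m < p" for m
    using that by blast
  have shift: "(of_bool (thue_morse (i + n)) - of_bool (thue_morse i) :: int)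
      = of_bool (thue_morse (i + p + n)) - of_bool (thue_morse (i + p))" if "n \<le> p" for n
    unfolding sum_thue_morse_diff[symmetric] using eq that by (intro sum.cong) auto
  \<comment> \<open>The changes from \<open>i\<close> to \<open>i + p\<close> and from
    \<open>i + p\<close> to \<open>i + p + p\<close> agree. Two equal nonzero jumps cannot both stay
    within {0, 1}, so the change is 0.\<close>
  have start: "thue_morse (i + p) = thue_morse i"
    using shift[of p] by (auto simp: of_bool_def split: if_splits)
  have "thue_morse (i + n) = thue_morse (i + p + n)" if "n \<le> p" for n
    using shift[OF that] start by (auto simp: of_bool_def split: if_splits)
  then show False using thue_morse_overlap_free[OF assms, of i] by blast
qed

lemma ordinary_avoidable_2:
  assumes "3 \<le> j"
  shows "ordinary_avoidable j 2"
  unfolding ordinary_avoidable_def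
proof (intro exI conjI)
  show "range thue_morse_diff \<subseteq> {..<j}"
    using assms thue_morse_diff_less_3 order.strict_trans2 by blast
  show "ordinary_free 2 thue_morse_diff"
  proof (rule ordinary_freeI)
    fix i p l :: nat
    assume l: "0 < l" "l \<le> p"
      and eq: "\<And>m. m < l \<Longrightarrow> thue_morse_diff (i + m) = thue_morse_diff (i + p + m)"
    \<comment> \<open>Exponent 2 is reached only when \<open>l = p\<close>, that is, by a
      square.\<close>
    have "l \<noteq> p" using thue_morse_diff_square_free[of p i] l eq by auto
    then show "real (p + l) / real p < 2" using l by (simp add: field_simps)
  qed
qed

section \<open>Comparison of the two infima\<close>

theorem theorem1:
  fixes k :: nat
  assumes "k \<ge> 9"
  shows "URT k \<le> RT (k div 3)"
  unfolding URT_def RT_def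
proof (rule cInf_superset_mono)
  \<comment> \<open>From \<open>k \<ge> 9\<close> follows \<open>k div 3 \<ge> 3\<close>, so the
    exponent 2 witnesses that the infimum on the right is over a nonempty set.\<close>
  have "ordinary_avoidable (k div 3) 2"
    using assms by (intro ordinary_avoidable_2) linarith
  then show "{r. 1 < r \<and> r \<le> 2 \<and> ordinary_avoidable (k div 3) r} \<noteq> {}"
    by (auto intro!: exI[of _ "2::real"])
  show "bdd_below {r. 1 < r \<and> r \<le> 2 \<and> undirected_avoidable k r}"
    by (intro bdd_belowI[of _ 1]) auto
  show "{r. 1 < r \<and> r \<le> 2 \<and> ordinary_avoidable (k div 3) r}
      \<subseteq> {r. 1 < r \<and> r \<le> 2 \<and> undirected_avoidable k r}"
    using undirected_avoidable_if_ordinary_avoidable by blast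
qed

end
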